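(* The integral $$I=\int_0^1\int_0^1\cdots\int_0^1 f(x_1+x_2+\dots+x_n)\,dx_1\,dx_2\cdots dx_n$$ satisfies the following formula: $$I=\frac{1}{(n-1)!}\sum_{m=1}^{n}\int_0^1 G_m(t)\,f(t+m-1)\,dt,$$ where $$G_m(t)=\sum_{i=1}^{m}(-1)^{i-1}(t+m-i)^{n-1}\binom{n}{i-1}.$$
   Context: Here $n$ is a positive integer (the dimension of the integral), $f$ is a function of one real variable, and $\binom{n}{i-1}$ denotes the binomial coefficient. The source states no explicit regularity or integrability hypothesis on $f$. *)

theory Defs
  imports "HOL-Analysis.Analysis"
begin

(* For n = 1 the exponent n - 1 is 0 and 0 ^ 0 = 1, so G 1 1 t = 1 for every t, including t = 0. *)
definition G :: "nat \<Rightarrow> nat \<Rightarrow> real \<Rightarrow> real" where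
  "G n m t = (\<Sum>i=1..m. (-1) ^ (i - 1) * (t + real m - real i) ^ (n - 1) * real (n choose (i - 1)))"

end

theory Submission
  imports Defs
begin

text \<open>
  The coordinate sum of a uniform point of the unit cube has the Irwin--Hall density
  \<open>h\<close>, obtained by iterated convolution with the uniform density: integrating a truncated
  power over \<open>[t - 1, t]\<close> gives a difference of truncated powers of the next degree, and
  Pascal's rule collects the binomial coefficients. Hence \<open>I = \<integral> h f\<close>, and on
  \<open>[m - 1, m]\<close> only the first \<open>m\<close> truncated powers are nonzero, which gives
  \<open>G\<^sub>m / (n - 1)!\<close>. Only the composition of \<open>f\<close> with the coordinate sum is known to be
  measurable; the measurability of \<open>h f\<close> follows because images of compact sets are compact.
\<close>

(* 0 ^ 0 = 1 makes trunc_pow 0 the indicator of [0, \<infinity>), so that the n = 1 density is the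
   indicator of the half-open interval [0, 1). *)
definition trunc_pow :: "nat \<Rightarrow> real \<Rightarrow> real" where
  "trunc_pow n x = (if x < 0 then 0 else x ^ n)"

section \<open>Primitives of truncated powers\<close>

lemma trunc_pow_Suc: "trunc_pow (Suc n) x = max 0 x ^ Suc n"
  by (auto simp: trunc_pow_def max_def)

lemma borel_measurable_trunc_pow [measurable]: "trunc_pow n \<in> borel_measurable borel"
  unfolding trunc_pow_def [abs_def] by measurable

text \<open>For \<open>n = 0\<close> the integrand jumps at 0, so the primitive is differentiated
  only away from 0. It is continuous there, which suffices for the fundamental theorem with a finite
  exceptional set.\<close>

lemma has_integral_trunc_pow:
  assumes "a \<le> b"
  shows "(trunc_pow n has_integral (trunc_pow (Suc n) b - trunc_pow (Suc n) a) / Suc n) {a..b}"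
proof -
  have "((\<lambda>x. trunc_pow (Suc n) x / Suc n) has_vector_derivative trunc_pow n x) (at x)"
    if "x \<in> {a<..<b} - {0}" for x
  proof (cases "x < 0")
    case True
    have "((\<lambda>x. 0) has_vector_derivative trunc_pow n x) (at x)"
      using True by (simp add: trunc_pow_def)
    then show ?thesis
      by (rule has_vector_derivative_transform_within_open[where S = "{..<0}"])
        (use True in \<open>auto simp: trunc_pow_def\<close>)
  next
    case False
    then have "x > 0" using that by auto
    have "((\<lambda>x. x ^ Suc n / Suc n) has_real_derivative x ^ n) (at x)"
      using DERIV_cdivide[OF DERIV_pow[of "Suc n" x], of "real (Suc n)"] by simp
    then have "((\<lambda>x. x ^ Suc n / Suc n) has_vector_derivative trunc_pow n x) (at x)"
      using \<open>x > 0\<close> by (simp add: trunc_pow_def has_real_derivative_iff_has_vector_derivative)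
    then show ?thesis
      by (rule has_vector_derivative_transform_within_open[where S = "{0<..}"])
        (use \<open>x > 0\<close> in \<open>auto simp: trunc_pow_def\<close>)
  qed
  moreover have "continuous_on {a..b} (\<lambda>x. trunc_pow (Suc n) x / Suc n)"
    unfolding trunc_pow_Suc by (intro continuous_intros) auto
  ultimately show ?thesis
    using fundamental_theorem_of_calculus_interior_strong[of "{0}" a b "\<lambda>x. trunc_pow (Suc n) x / Suc n" "trunc_pow n"] assms
    by (simp add: diff_divide_distrib)
qed

section \<open>The Irwin-Hall density and its recursion\<close>

text \<open>For n > 0 this is the n-th backward difference with step 1 of the truncated power of
  degree n - 1, divided by (n - 1)!; in other words, the cardinal B-spline of degree n - 1.\<close>

definition irwin_hall :: "nat \<Rightarrow> real \<Rightarrow> real" where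
  "irwin_hall n t =
     (\<Sum>k\<le>n. (-1) ^ k * real (n choose k) * trunc_pow (n - 1) (t - real k)) / fact (n - 1)"

lemma borel_measurable_irwin_hall [measurable]: "irwin_hall n \<in> borel_measurable borel"
  unfolding irwin_hall_def [abs_def] by measurable

lemma irwin_hall_1: "irwin_hall (Suc 0) t = indicator {0..<1} t"
  by (auto simp: irwin_hall_def trunc_pow_def indicator_def)

text \<open>One more difference applied to an n-th difference gives the (n+1)-st. It is used with
  \<open>p k\<close> equal to \<open>trunc_pow n (t - real k)\<close>.\<close>

lemma alternating_binomial_sum_Suc:
  fixes p :: "nat \<Rightarrow> real"
  shows "(\<Sum>k\<le>n. (-1) ^ k * real (n choose k) * (p k - p (Suc k))) =
    (\<Sum>k\<le>Suc n. (-1) ^ k * real (Suc n choose k) * p k)"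
proof -
  have "(\<Sum>k\<le>Suc n. (-1) ^ k * real (Suc n choose k) * p k) =
      p 0 - (\<Sum>k\<le>n. (-1) ^ k * (real (n choose k) + real (n choose Suc k)) * p (Suc k))"
    by (subst sum.atMost_Suc_shift) (simp add: sum_negf)
  also have "\<dots> = (p 0 + (\<Sum>k\<le>n. (-1) ^ Suc k * real (n choose Suc k) * p (Suc k))) -
      (\<Sum>k\<le>n. (-1) ^ k * real (n choose k) * p (Suc k))"
    by (simp add: algebra_simps sum.distrib sum_negf)
  also have "p 0 + (\<Sum>k\<le>n. (-1) ^ Suc k * real (n choose Suc k) * p (Suc k)) =
      (\<Sum>k\<le>Suc n. (-1) ^ k * real (n choose k) * p k)"
    by (subst sum.atMost_Suc_shift) simp
  \<comment> \<open>The top term vanishes because \<open>n choose Suc n\<close> is 0.\<close>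
  also have "\<dots> = (\<Sum>k\<le>n. (-1) ^ k * real (n choose k) * p k)"
    by simp
  finally show ?thesis
    by (simp add: sum_subtractf algebra_simps)
qed

text \<open>Integration over a window of length 1 is convolution with the uniform density. Each
  truncated power contributes a difference of consecutive shifts, and the factor
  \<open>1 / n\<close> raises the factorial from (n - 1)! to n!.\<close>

lemma has_integral_irwin_hall:
  assumes "n > 0"
  shows "(irwin_hall n has_integral irwin_hall (Suc n) t) {t - 1..t}"
proof -
  obtain m where n: "n = Suc m" using assms by (cases n) auto
  have shift: "((\<lambda>s. trunc_pow m (s - real k)) has_integral
      (trunc_pow n (t - real k) - trunc_pow n (t - real (Suc k))) / n) {t - 1..t}" for k
    using has_integral_shift_cbox_iff[of "trunc_pow m" "- real k" _ "t - 1" t]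
      has_integral_trunc_pow[of "t - 1 - real k" "t - real k" m]
    by (simp add: n o_def algebra_simps)
  have "((\<lambda>s. (\<Sum>k\<le>n. (-1) ^ k * real (n choose k) * trunc_pow m (s - real k)) / fact m) has_integral
     (\<Sum>k\<le>n. (-1) ^ k * real (n choose k) *
        ((trunc_pow n (t - real k) - trunc_pow n (t - real (Suc k))) / n)) / fact m) {t - 1..t}"
    by (intro has_integral_divide has_integral_sum has_integral_mult_right shift) auto
  also have "(\<Sum>k\<le>n. (-1) ^ k * real (n choose k) *
        ((trunc_pow n (t - real k) - trunc_pow n (t - real (Suc k))) / n)) / fact m =
      irwin_hall (Suc n) t"
    unfolding irwin_hall_def alternating_binomial_sum_Suc[symmetric]
    by (simp add: n sum_divide_distrib mult_ac del: sum.atMost_Suc)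
  finally show ?thesis
    by (simp add: irwin_hall_def [abs_def] n)
qed

text \<open>The sign is not visible in the alternating sum; it is inherited along the integral
  recursion.\<close>

lemma irwin_hall_nonneg: "n > 0 \<Longrightarrow> irwin_hall n t \<ge> 0"
proof (induction n arbitrary: t rule: nat_induct_non_zero)
  case 1
  show ?case by (simp add: irwin_hall_1)
next
  case (Suc n)
  then show ?case
    using has_integral_nonneg[OF has_integral_irwin_hall] by blast
qed

text \<open>In the induction step the window \<open>{t - 1..t}\<close> lies left of 0 or in [n,
  infinity), where the previous density vanishes. This avoids evaluating an n-th difference of a
  polynomial of degree n - 1 for large \<open>t\<close>.\<close>

lemma irwin_hall_eq_0:
  assumes "n > 0" "t \<notin> {0..<real n}"
  shows "irwin_hall n t = 0"
  using assms
proof (induction n arbitrary: t rule: nat_induct_non_zero)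
  case 1
  then show ?case by (simp add: irwin_hall_1)
next
  case (Suc n)
  have "irwin_hall n s = 0" if "s \<in> {t - 1..t} - {0}" for s
    using Suc.prems that by (intro Suc.IH) auto
  then have "(irwin_hall n has_integral 0) {t - 1..t}"
    using has_integral_spike_finite[of "{0}" "{t - 1..t}" "irwin_hall n" "\<lambda>_. 0" 0] by simp
  then show ?case
    using has_integral_irwin_hall[OF Suc.hyps] has_integral_unique by blast
qed

section \<open>The law of the coordinate sum on the unit cube\<close>

lemma nn_integral_irwin_hall:
  assumes "n > 0"
  shows "(\<integral>\<^sup>+s. ennreal (irwin_hall n s) * indicator {0..1} (t - s) \<partial>lborel) =
    ennreal (irwin_hall (Suc n) t)"
proof -
  have "(\<integral>\<^sup>+s. ennreal (irwin_hall n s) * indicator {0..1} (t - s) \<partial>lborel) =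
      (\<integral>\<^sup>+s. ennreal (irwin_hall n s) * indicator {t - 1..t} s \<partial>lborel)"
    by (intro nn_integral_cong) (auto simp: indicator_def)
  also have "\<dots> = ennreal (irwin_hall (Suc n) t)"
    using assms by (intro nn_integral_has_integral_lebesgue' has_integral_irwin_hall irwin_hall_nonneg)
  finally show ?thesis .
qed

text \<open>Substitute t = s + y and exchange the integrals by Tonelli; the inner integral over
  \<open>s\<close> is then the density recursion.\<close>

lemma nn_integral_irwin_hall_convolution:
  fixes f :: "real \<Rightarrow> ennreal"
  assumes "n > 0" and [measurable]: "f \<in> borel_measurable borel"
  shows "(\<integral>\<^sup>+s. ennreal (irwin_hall n s) * (\<integral>\<^sup>+y. indicator {0..1} y * f (s + y) \<partial>lborel) \<partial>lborel) =
    (\<integral>\<^sup>+t. ennreal (irwin_hall (Suc n) t) * f t \<partial>lborel)"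
proof -
  have "(\<integral>\<^sup>+y. indicator {0..1} y * f (s + y) \<partial>lborel) =
      (\<integral>\<^sup>+t. indicator {0..1} (t - s) * f t \<partial>lborel)" for s :: real
    by (subst nn_integral_real_affine[where c = 1 and t = "- s"]) auto
  then have "(\<integral>\<^sup>+s. ennreal (irwin_hall n s) * (\<integral>\<^sup>+y. indicator {0..1} y * f (s + y) \<partial>lborel) \<partial>lborel) =
      (\<integral>\<^sup>+s. \<integral>\<^sup>+t. ennreal (irwin_hall n s) * (indicator {0..1} (t - s) * f t) \<partial>lborel \<partial>lborel)"
    by (simp add: nn_integral_cmult)
  also have "\<dots> = (\<integral>\<^sup>+t. \<integral>\<^sup>+s. ennreal (irwin_hall n s) * (indicator {0..1} (t - s) * f t) \<partial>lborel \<partial>lborel)"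
    by (rule lborel_pair.Fubini') measurable
  also have "\<dots> = (\<integral>\<^sup>+t. (\<integral>\<^sup>+s. ennreal (irwin_hall n s) * indicator {0..1} (t - s) \<partial>lborel) * f t \<partial>lborel)"
    by (simp add: nn_integral_multc flip: mult.assoc)
  finally show ?thesis
    by (simp add: nn_integral_irwin_hall[OF \<open>n > 0\<close>])
qed

text \<open>Coordinates are split off one at a time. \<open>f\<close> must be arbitrary in the
  induction, since the hypothesis is applied to the average of \<open>f\<close> over [s, s + 1] as a
  function of \<open>s\<close>.\<close>

lemma nn_integral_PiM_sum_unit_interval:
  fixes f :: "real \<Rightarrow> ennreal"
  assumes "finite I" "I \<noteq> {}" and "f \<in> borel_measurable borel"
  shows "(\<integral>\<^sup>+x. (\<Prod>i\<in>I. indicator {0..1} (x i)) * f (\<Sum>i\<in>I. x i) \<partial>(\<Pi>\<^sub>M i\<in>I. lborel)) =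
    (\<integral>\<^sup>+t. ennreal (irwin_hall (card I) t) * f t \<partial>lborel)"
  using assms
proof (induction I arbitrary: f rule: finite_ne_induct)
  interpret product_sigma_finite "\<lambda>_. lborel :: real measure" ..
  {
    case (singleton i)
    note [measurable] = singleton
    have "(\<integral>\<^sup>+x. indicator {0..1} (x i) * f (x i) \<partial>(\<Pi>\<^sub>M i\<in>{i}. lborel)) =
      (\<integral>\<^sup>+t. indicator {0..1} t * f t \<partial>lborel)"
      by (rule product_nn_integral_singleton) measurable
    also have "\<dots> = (\<integral>\<^sup>+t. ennreal (irwin_hall (Suc 0) t) * f t \<partial>lborel)"
      \<comment> \<open>The closed interval and the support [0, 1) of the density differ only at the
        point 1.\<close>
      using AE_lborel_singleton[of "1::real"]
      by (intro nn_integral_cong_AE) (auto simp: irwin_hall_1 indicator_def elim!: eventually_mono)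
    finally show ?case by simp
  next
    case (insert i I)
    note [measurable] = insert.prems
    have "(\<integral>\<^sup>+x. (\<Prod>j\<in>insert i I. indicator {0..1} (x j)) * f (\<Sum>j\<in>insert i I. x j) \<partial>(\<Pi>\<^sub>M j\<in>insert i I. lborel)) =
      (\<integral>\<^sup>+x. \<integral>\<^sup>+y. (\<Prod>j\<in>insert i I. indicator {0..1} ((x(i := y)) j)) *
        f (\<Sum>j\<in>insert i I. (x(i := y)) j) \<partial>lborel \<partial>(\<Pi>\<^sub>M j\<in>I. lborel))"
      using insert.hyps by (intro product_nn_integral_insert) measurable
    also have "\<dots> = (\<integral>\<^sup>+x. \<integral>\<^sup>+y. (\<Prod>j\<in>I. indicator {0..1} (x j)) *
        (indicator {0..1} y * f ((\<Sum>j\<in>I. x j) + y)) \<partial>lborel \<partial>(\<Pi>\<^sub>M j\<in>I. lborel))"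
    proof (intro nn_integral_cong)
      fix x :: "'a \<Rightarrow> real" and y :: real
      have "(\<Prod>j\<in>I. indicator {0..1} ((x(i := y)) j) :: ennreal) = (\<Prod>j\<in>I. indicator {0..1} (x j))"
        "(\<Sum>j\<in>I. (x(i := y)) j) = (\<Sum>j\<in>I. x j)"
        using insert.hyps by (auto intro!: prod.cong sum.cong split: if_splits)
      then show "(\<Prod>j\<in>insert i I. indicator {0..1} ((x(i := y)) j)) * f (\<Sum>j\<in>insert i I. (x(i := y)) j) =
          (\<Prod>j\<in>I. indicator {0..1} (x j)) * (indicator {0..1} y * f ((\<Sum>j\<in>I. x j) + y))"
        using insert.hyps by (simp add: mult_ac add.commute)
    qed
    also have "\<dots> = (\<integral>\<^sup>+x. (\<Prod>j\<in>I. indicator {0..1} (x j)) *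
        (\<integral>\<^sup>+y. indicator {0..1} y * f ((\<Sum>j\<in>I. x j) + y) \<partial>lborel) \<partial>(\<Pi>\<^sub>M j\<in>I. lborel))"
      by (intro nn_integral_cong nn_integral_cmult) measurable
    also have "\<dots> = (\<integral>\<^sup>+s. ennreal (irwin_hall (card I) s) *
        (\<integral>\<^sup>+y. indicator {0..1} y * f (s + y) \<partial>lborel) \<partial>lborel)"
      by (rule insert.IH) measurable
    also have "\<dots> = (\<integral>\<^sup>+t. ennreal (irwin_hall (Suc (card I)) t) * f t \<partial>lborel)"
      using insert.hyps by (intro nn_integral_irwin_hall_convolution) (auto simp: card_gt_0_iff)
    finally show ?case
      using insert.hyps by simp
  }
qed

lemma nn_integral_cube_sum:
  fixes f :: "real \<Rightarrow> ennreal"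
  assumes [measurable]: "f \<in> borel_measurable borel"
  shows "(\<integral>\<^sup>+x. indicator (cbox 0 One) x * f (\<Sum>b\<in>Basis. x \<bullet> b) \<partial>(lborel :: 'a::euclidean_space measure)) =
    (\<integral>\<^sup>+t. ennreal (irwin_hall DIM('a) t) * f t \<partial>lborel)"
proof -
  have "(\<integral>\<^sup>+x. indicator (cbox 0 One) x * f (\<Sum>b\<in>Basis. x \<bullet> b) \<partial>(lborel :: 'a measure)) =
     (\<integral>\<^sup>+x. (\<Prod>b\<in>Basis. indicator {0..1} (x b)) * f (\<Sum>b\<in>Basis. x b) \<partial>(\<Pi>\<^sub>M b\<in>(Basis :: 'a set). lborel))"
    \<comment> \<open>Lebesgue measure is presented as the image of the product measure over
      \<open>Basis\<close> under the map from coordinates to vectors.\<close>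
    unfolding lborel_eq[where 'a = 'a]
  proof (subst nn_integral_distr)
    show "(\<integral>\<^sup>+x. indicator (cbox 0 One) (\<Sum>b\<in>Basis. x b *\<^sub>R b :: 'a) *
        f (\<Sum>b\<in>Basis. (\<Sum>b\<in>Basis. x b *\<^sub>R b) \<bullet> b) \<partial>(\<Pi>\<^sub>M b\<in>Basis. lborel)) =
      (\<integral>\<^sup>+x. (\<Prod>b\<in>Basis. indicator {0..1} (x b)) * f (\<Sum>b\<in>Basis. x b) \<partial>(\<Pi>\<^sub>M b\<in>(Basis :: 'a set). lborel))"
    proof (intro nn_integral_cong)
      fix x :: "'a \<Rightarrow> real"
      have "indicator (cbox 0 One) (\<Sum>b\<in>Basis. x b *\<^sub>R b :: 'a) = (\<Prod>b\<in>(Basis :: 'a set). indicator {0..1} (x b) :: ennreal)"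
        by (auto simp: mem_box indicator_def intro!: prod.neutral)
      then show "indicator (cbox 0 One) (\<Sum>b\<in>Basis. x b *\<^sub>R b :: 'a) *
          f (\<Sum>b\<in>Basis. (\<Sum>b\<in>Basis. x b *\<^sub>R b :: 'a) \<bullet> b) =
        (\<Prod>b\<in>(Basis :: 'a set). indicator {0..1} (x b)) * f (\<Sum>b\<in>Basis. x b)"
        by simp
    qed
  qed measurable
  then show ?thesis
    by (simp add: nn_integral_PiM_sum_unit_interval)
qed

lemma distr_cube_sum:
  "distr (density lborel (indicator (cbox 0 One))) borel (\<lambda>x::'a::euclidean_space. \<Sum>b\<in>Basis. x \<bullet> b) =
    density lborel (\<lambda>t. ennreal (irwin_hall DIM('a) t))"
proof (rule measure_eqI)
  fix A :: "real set"
  assume "A \<in> sets (distr (density lborel (indicator (cbox 0 One))) borel (\<lambda>x::'a. \<Sum>b\<in>Basis. x \<bullet> b))"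
  then have [measurable]: "A \<in> sets borel" by simp
  have "emeasure (distr (density lborel (indicator (cbox 0 One))) borel (\<lambda>x::'a. \<Sum>b\<in>Basis. x \<bullet> b)) A =
     (\<integral>\<^sup>+x. indicator (cbox 0 One) x * indicator A (\<Sum>b\<in>Basis. x \<bullet> b) \<partial>(lborel :: 'a measure))"
    by (simp add: nn_integral_distr nn_integral_density flip: nn_integral_indicator)
  then show "emeasure (distr (density lborel (indicator (cbox 0 One))) borel (\<lambda>x::'a. \<Sum>b\<in>Basis. x \<bullet> b)) A =
      emeasure (density lborel (\<lambda>t. ennreal (irwin_hall DIM('a) t))) A"
    by (simp add: nn_integral_cube_sum emeasure_density)
qed simp

section \<open>Measurability through the image measure\<close>

text \<open>
  The sets \<open>P = {x \<in> C. a < f (S x)}\<close> and \<open>Q = C - P\<close> contain F-sigma sets of full measure.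
  The images of these under \<open>S\<close> are Borel, lie in \<open>{y. a < f y}\<close> and in its complement
  respectively, and together exhaust the image measure.
\<close>

lemma borel_measurable_completion_distr:
  fixes S :: "'a::euclidean_space \<Rightarrow> 'b::euclidean_space" and f :: "'b \<Rightarrow> real"
  assumes S: "continuous_on UNIV S" and [measurable]: "C \<in> sets borel"
    and f: "(\<lambda>x. f (S x)) \<in> borel_measurable (lebesgue_on C)"
  shows "f \<in> borel_measurable (completion (distr (density lborel (indicator C)) borel S))"
proof -
  define M where "M = distr (density lborel (indicator C)) borel S"
  have S_meas [measurable]: "S \<in> borel_measurable borel"
    using S by (rule borel_measurable_continuous_onI)
  have "{y. a < f y} \<in> sets (completion M)" for a
  proof -
    define P where "P = {x \<in> C. a < f (S x)}"
    define Q where "Q = {x \<in> C. \<not> a < f (S x)}"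
    have C: "C \<in> sets lebesgue" by simp
    have "P \<in> sets (lebesgue_on C)"
      using f by (simp add: P_def borel_measurable_iff_greater)
    then have P: "P \<in> sets lebesgue"
      using C by (simp add: sets_restrict_space_iff)
    have "Q = C - P" by (auto simp: P_def Q_def)
    with P C have Q: "Q \<in> sets lebesgue" by auto
    have image: "\<exists>B N. B \<in> sets borel \<and> B \<subseteq> S ` X \<and> N \<in> null_sets lebesgue \<and> X \<subseteq> S -` B \<union> N"
      if X_leb: "X \<in> sets lebesgue" for X
    proof -
      obtain K N where K: "fsigma K" and N: "N \<in> null_sets lebesgue" and X: "K \<union> N = X"
        using lebesgue_set_almost_fsigma[OF X_leb] by metis
      obtain F :: "nat \<Rightarrow> 'a set" where F: "range F \<subseteq> Collect compact" "K = \<Union>(range F)"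
        using K fsigma_Union_compact by metis
      have "compact (S ` F n)" for n
        using F(1) S by (intro compact_continuous_image) (auto intro: continuous_on_subset)
      then have "(\<Union>n. S ` F n) \<in> sets borel"
        by (intro sets.countable_UN) (auto intro: borel_compact)
      moreover have "S ` K = (\<Union>n. S ` F n)"
        using F(2) by auto
      ultimately have "S ` K \<in> sets borel" by simp
      then show ?thesis
        using N X by (intro exI[of _ "S ` K"] exI[of _ N]) auto
    qed
    obtain A NA where A [measurable]: "A \<in> sets borel" and A_sub: "A \<subseteq> S ` P"
      and NA: "NA \<in> null_sets lebesgue" "P \<subseteq> S -` A \<union> NA"
      using image[OF P] by metis
    obtain B NB where B [measurable]: "B \<in> sets borel" and B_sub: "B \<subseteq> S ` Q"
      and NB: "NB \<in> null_sets lebesgue" "Q \<subseteq> S -` B \<union> NB"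
      using image[OF Q] by metis
    \<comment> \<open>The \<open>M\<close>-measure of the set missed by \<open>A\<close> and
      \<open>B\<close> is the Lebesgue measure of this set, which lies in
      \<open>NA \<union> NB\<close> because \<open>P\<close> and \<open>Q\<close> cover
      \<open>C\<close>.\<close>
    have CAB: "C \<inter> S -` (- (A \<union> B)) \<in> sets borel"
      using measurable_sets[OF S_meas, of "- (A \<union> B)"] by auto
    have "C \<inter> S -` (- (A \<union> B)) \<subseteq> NA \<union> NB"
      using NA(2) NB(2) by (auto simp: P_def Q_def)
    moreover have "NA \<union> NB \<in> null_sets lebesgue"
      using NA(1) NB(1) by auto
    ultimately have "C \<inter> S -` (- (A \<union> B)) \<in> null_sets lebesgue"
      by (rule null_sets_completion_subset)
    then have "C \<inter> S -` (- (A \<union> B)) \<in> null_sets lborel"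
      by (subst (asm) null_sets_completion_iff) (use CAB in auto)
    then have "emeasure lborel (C \<inter> S -` (- (A \<union> B))) = 0"
      by auto
    then have "- (A \<union> B) \<in> null_sets M"
      using measurable_sets[OF S_meas, of "- (A \<union> B)"]
      by (auto simp: M_def null_sets_def emeasure_distr emeasure_density indicator_inter_arith[symmetric])
    moreover have "{y. a < f y} = A \<union> ({y. a < f y} \<inter> - (A \<union> B))"
      using A_sub B_sub by (auto simp: P_def Q_def)
    ultimately show ?thesis
      by (intro sets_completionI[of _ A "{y. a < f y} \<inter> - (A \<union> B)" "- (A \<union> B)"]) (auto simp: M_def)
  qed
  then show ?thesis
    by (simp add: borel_measurable_iff_greater M_def)
qed

section \<open>Transfer of the cube integral to the line\<close>

text \<open>Links almost-everywhere equality to the spike rules for negligible sets, so that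
  \<open>f\<close> may be exchanged for a Borel representative.\<close>

lemma absolutely_integrable_AE_cong:
  fixes f g :: "'a::euclidean_space \<Rightarrow> real"
  assumes "AE x in lborel. x \<in> T \<longrightarrow> f x = g x"
  shows "f absolutely_integrable_on T \<longleftrightarrow> g absolutely_integrable_on T"
    and "integral T f = integral T g"
proof -
  obtain N where N: "N \<in> null_sets lborel" "\<And>x. x \<notin> N \<Longrightarrow> x \<in> T \<Longrightarrow> f x = g x"
    using assms by (auto elim!: AE_E3)
  have "negligible N"
    using N(1) by (simp add: negligible_iff_null_sets null_sets_completionI)
  show "f absolutely_integrable_on T \<longleftrightarrow> g absolutely_integrable_on T"
    using absolutely_integrable_spike[where S = N and T = T and f = f and g = g]
      absolutely_integrable_spike[where S = N and T = T and f = g and g = f]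
      \<open>negligible N\<close> N(2) by auto
  show "integral T f = integral T g"
    using \<open>negligible N\<close> N(2) by (intro integral_spike[where S = N]) auto
qed

text \<open>Under the law of the coordinate sum, \<open>f\<close> agrees almost everywhere with a
  Borel function \<open>g\<close>. This equality pulls back along \<open>S\<close> to the cube and
  passes through the density \<open>h\<close> to the line; for \<open>g\<close> itself the claim is
  the image-measure formula.\<close>

lemma
  fixes f :: "real \<Rightarrow> real"
  assumes "(\<lambda>x::'a::euclidean_space. f (\<Sum>b\<in>Basis. x \<bullet> b)) absolutely_integrable_on cbox 0 One"
  shows absolutely_integrable_irwin_hall:
      "(\<lambda>t. irwin_hall DIM('a) t * f t) absolutely_integrable_on UNIV"
    and integral_cube_sum:
      "integral (cbox 0 One) (\<lambda>x::'a. f (\<Sum>b\<in>Basis. x \<bullet> b)) =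
        integral UNIV (\<lambda>t. irwin_hall DIM('a) t * f t)"
proof -
  define S where "S = (\<lambda>x::'a. \<Sum>b\<in>Basis. x \<bullet> b)"
  define C where "C = (cbox 0 One :: 'a set)"
  define h where "h = irwin_hall DIM('a)"
  define U where "U = density lborel (\<lambda>x. ennreal (indicator C x))"
  have [measurable]: "S \<in> borel_measurable borel" "C \<in> sets borel" "h \<in> borel_measurable borel"
    by (auto simp: S_def C_def h_def)
  have S_cont: "continuous_on UNIV S"
    unfolding S_def by (intro continuous_intros)
  have h: "h t \<ge> 0" for t
    by (simp add: h_def irwin_hall_nonneg)
  have distr: "distr U borel S = density lborel (\<lambda>t. ennreal (h t))"
    using distr_cube_sum[where 'a = 'a] by (simp add: S_def C_def h_def U_def ennreal_indicator)
  have fS: "(\<lambda>x. f (S x)) absolutely_integrable_on C"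
    using assms by (simp add: S_def C_def)
  then have "(\<lambda>x. f (S x)) \<in> borel_measurable (lebesgue_on C)"
    by (subst (asm) absolutely_integrable_measurable) auto
  from borel_measurable_completion_distr[OF S_cont _ this]
  have f_meas: "f \<in> borel_measurable (completion (distr U borel S))"
    by (simp add: U_def ennreal_indicator)
  obtain g where "g \<in> borel_measurable (distr U borel S)"
    and AE_g: "AE t in distr U borel S. f t = g t"
    using completion_ex_borel_measurable_real[OF f_meas] by blast
  then have [measurable]: "g \<in> borel_measurable borel" by simp
  have "AE t in lborel. 0 < h t \<longrightarrow> f t = g t"
    using AE_g unfolding distr by (subst (asm) AE_density) auto
  \<comment> \<open>Where \<open>h\<close> is 0 both products vanish, whatever the values of
    \<open>f\<close> and \<open>g\<close>.\<close>
  then have AE_h: "AE t in lborel. t \<in> UNIV \<longrightarrow> h t * f t = h t * g t"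
    using h by (auto elim!: eventually_mono simp: less_le)
  have "AE x in U. f (S x) = g (S x)"
    using AE_g by (rule AE_distrD[rotated]) (simp add: U_def)
  then have "AE x in lborel. 0 < ennreal (indicator C x) \<longrightarrow> f (S x) = g (S x)"
    unfolding U_def by (subst (asm) AE_density) auto
  then have AE_C: "AE x in lborel. x \<in> C \<longrightarrow> f (S x) = g (S x)"
    by eventually_elim auto
  have "(\<lambda>x. g (S x)) absolutely_integrable_on C"
    using fS absolutely_integrable_AE_cong(1)[OF AE_C] by simp
  \<comment> \<open>As \<open>g\<close> composed with \<open>S\<close> is Borel, integrability for
    \<open>lebesgue\<close> and for \<open>lborel\<close> coincide here.\<close>
  then have int_U: "integrable U (\<lambda>x. g (S x))"
    by (simp add: U_def integrable_density set_integrable_def integrable_completion)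
  then have "integrable (density lborel (\<lambda>t. ennreal (h t))) g"
    by (simp add: integrable_distr_eq U_def flip: distr)
  then have int_h: "integrable lborel (\<lambda>t. h t * g t)"
    using h by (simp add: integrable_density)
  then have abs_h: "(\<lambda>t. h t * g t) absolutely_integrable_on UNIV"
    by (simp add: set_integrable_def integrable_completion)
  then have "(\<lambda>t. h t * f t) absolutely_integrable_on UNIV"
    using absolutely_integrable_AE_cong(1)[OF AE_h] by simp
  then show "(\<lambda>t. irwin_hall DIM('a) t * f t) absolutely_integrable_on UNIV"
    by (simp add: h_def)
  have "integral C (\<lambda>x. f (S x)) = integral C (\<lambda>x. g (S x))"
    by (rule absolutely_integrable_AE_cong(2)[OF AE_C])
  also have "\<dots> = (LINT x:C|lebesgue. g (S x))"
    using \<open>(\<lambda>x. g (S x)) absolutely_integrable_on C\<close> by (simp add: set_lebesgue_integral_eq_integral)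
  also have "\<dots> = (LINT x|U. g (S x))"
    by (simp add: U_def integral_density set_lebesgue_integral_def integral_completion)
  also have "\<dots> = (LINT t|density lborel (\<lambda>t. ennreal (h t)). g t)"
    by (simp add: integral_distr U_def flip: distr)
  also have "\<dots> = (LINT t|lborel. h t * g t)"
    using h by (simp add: integral_density)
  also have "\<dots> = integral UNIV (\<lambda>t. h t * g t)"
    using int_h by (simp add: integral_lborel)
  also have "\<dots> = integral UNIV (\<lambda>t. h t * f t)"
    by (rule absolutely_integrable_AE_cong(2)[OF AE_h, symmetric])
  finally show "integral (cbox 0 One) (\<lambda>x::'a. f (\<Sum>b\<in>Basis. x \<bullet> b)) =
      integral UNIV (\<lambda>t. irwin_hall DIM('a) t * f t)"
    by (simp add: C_def S_def h_def)
qed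

section \<open>Cutting the density into unit intervals\<close>

text \<open>The truncated powers with k >= m have negative argument and drop out, and those with k <
  m have nonnegative argument and are ordinary powers. At t = 1 the identity fails for n = 1, where
  \<open>G\<close> is 1 and the density is 0.\<close>

lemma G_eq_irwin_hall:
  assumes "n > 0" "m \<in> {1..n}" "t \<in> {0..<1}"
  shows "G n m t = fact (n - 1) * irwin_hall n (t + real m - 1)"
proof -
  have "fact (n - 1) * irwin_hall n (t + real m - 1) =
      (\<Sum>k\<le>n. (-1) ^ k * real (n choose k) * trunc_pow (n - 1) (t + real m - 1 - real k))"
    by (simp add: irwin_hall_def)
  also have "\<dots> = (\<Sum>k<m. (-1) ^ k * real (n choose k) * trunc_pow (n - 1) (t + real m - 1 - real k))"
    using assms by (intro sum.mono_neutral_right) (auto simp: trunc_pow_def)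
  also have "\<dots> = (\<Sum>k<m. (-1) ^ k * real (n choose k) * (t + real m - real (Suc k)) ^ (n - 1))"
    using assms by (intro sum.cong) (auto simp: trunc_pow_def algebra_simps)
  also have "\<dots> = G n m t"
    unfolding G_def
    \<comment> \<open>The indices are related by i = k + 1.\<close>
    by (rule sum.reindex_bij_witness[of _ "\<lambda>i. i - 1" Suc]) auto
  finally show ?thesis by simp
qed

lemma integral_sum_unit_intervals:
  fixes \<phi> :: "real \<Rightarrow> real"
  assumes "\<phi> integrable_on {0..real n}"
  shows "integral {0..real n} \<phi> = (\<Sum>m=1..n. integral {real m - 1..real m} \<phi>)"
  using assms
proof (induction n)
  case (Suc n)
  have "\<phi> integrable_on {0..real n}"
    using Suc.prems by (rule integrable_on_subinterval) auto
  then show ?case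
    using Suc.IH Henstock_Kurzweil_Integration.integral_combine[OF _ _ Suc.prems, of "real n"] by simp
qed simp

theorem theorem1p1:
  fixes f :: "real \<Rightarrow> real"
  assumes "(\<lambda>x :: real ^ 'n::finite. f (\<Sum>i\<in>UNIV. x $ i)) absolutely_integrable_on cbox 0 1"
  shows "(\<forall>m\<in>{1..CARD('n)}.
            (\<lambda>t. G CARD('n) m t * f (t + real m - 1)) absolutely_integrable_on {0..1}) \<and>
         integral (cbox 0 1) (\<lambda>x :: real ^ 'n. f (\<Sum>i\<in>UNIV. x $ i)) =
           1 / fact (CARD('n) - 1) *
             (\<Sum>m=1..CARD('n). integral {0..1} (\<lambda>t. G CARD('n) m t * f (t + real m - 1)))"
proof -
  define n where "n = CARD('n)"
  define \<phi> where "\<phi> = (\<lambda>t. irwin_hall n t * f t)"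
  have n: "n > 0" by (simp add: n_def)
  \<comment> \<open>The general results sum over \<open>Basis\<close>, whose elements here are the
    vectors \<open>axis i 1\<close>.\<close>
  have basis_sum: "(\<Sum>b\<in>Basis. x \<bullet> b) = (\<Sum>i\<in>UNIV. x $ i)" for x :: "real ^ 'n"
  proof -
    have "(Basis :: (real ^ 'n) set) = (\<lambda>i. axis i 1) ` UNIV"
      by (auto simp: Basis_vec_def)
    then have "(\<Sum>b\<in>Basis. x \<bullet> b) = (\<Sum>b\<in>(\<lambda>i. axis i 1) ` UNIV. x \<bullet> b)"
      by (rule arg_cong)
    also have "\<dots> = (\<Sum>i\<in>UNIV. x \<bullet> axis i 1)"
      by (subst sum.reindex) (auto simp: inj_on_def axis_eq_axis)
    finally show ?thesis
      by (simp add: inner_axis)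
  qed
  have One: "(One :: real ^ 'n) = 1"
  proof -
    have "(One :: real ^ 'n) $ i = 1" for i
      unfolding cart_eq_inner_axis[of One] by (rule inner_sum_Basis) (auto simp: Basis_vec_def)
    then show ?thesis
      by (simp add: vec_eq_iff)
  qed
  have abs_\<phi>: "\<phi> absolutely_integrable_on UNIV"
    and int_\<phi>: "integral (cbox 0 1) (\<lambda>x :: real ^ 'n. f (\<Sum>i\<in>UNIV. x $ i)) = integral UNIV \<phi>"
    using absolutely_integrable_irwin_hall[of f, where 'a = "real ^ 'n"]
      integral_cube_sum[of f, where 'a = "real ^ 'n"] assms
    by (simp_all add: basis_sum One \<phi>_def n_def)
  have piece: "(\<lambda>t. G n m t * f (t + real m - 1)) absolutely_integrable_on {0..1} \<and>
      integral {0..1} (\<lambda>t. G n m t * f (t + real m - 1)) = fact (n - 1) * integral {real m - 1..real m} \<phi>"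
    if m: "m \<in> {1..n}" for m
  proof -
    have "\<phi> absolutely_integrable_on {real m - 1..real m}"
      by (rule absolutely_integrable_on_subinterval[OF abs_\<phi>]) simp
    moreover have deriv: "((\<lambda>t. t + (real m - 1)) has_real_derivative 1) (at t within {0..1})" for t
      by (auto intro!: derivative_eq_intros)
    moreover have "(\<lambda>t. t + (real m - 1)) ` {0..1} = {real m - 1..real m}"
      by (simp add: add.commute[of _ "real m - 1"])
    ultimately have "(\<lambda>t. \<phi> (t + (real m - 1))) absolutely_integrable_on {0..1} \<and>
        integral {0..1} (\<lambda>t. \<phi> (t + (real m - 1))) = integral {real m - 1..real m} \<phi>"
      using has_absolute_integral_change_of_variables_1'[of "{0..1}" "\<lambda>t. t + (real m - 1)" "\<lambda>_. 1" \<phi>] deriv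
      by (auto simp: inj_on_def)
    then have shifted: "(\<lambda>t. fact (n - 1) * \<phi> (t + real m - 1)) absolutely_integrable_on {0..1} \<and>
        integral {0..1} (\<lambda>t. fact (n - 1) * \<phi> (t + real m - 1)) =
          fact (n - 1) * integral {real m - 1..real m} \<phi>"
      by (simp add: algebra_simps)
    \<comment> \<open>The identity for \<open>G\<close> covers only t < 1; the endpoint 1 is
      discarded as a null set.\<close>
    have "AE t in lborel. t \<in> {0..1} \<longrightarrow>
        G n m t * f (t + real m - 1) = fact (n - 1) * \<phi> (t + real m - 1)"
      using AE_lborel_singleton[of "1::real"]
      by eventually_elim (use n m in \<open>auto simp: \<phi>_def G_eq_irwin_hall\<close>)
    from absolutely_integrable_AE_cong[OF this] show ?thesis
      using shifted by simp
  qed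
  \<comment> \<open>The density is supported in [0, n], so the integral over the line reduces to the
    n unit intervals.\<close>
  have "\<phi> t = 0" if "t \<notin> {0..real n}" for t
    using irwin_hall_eq_0[OF n, of t] that by (auto simp: \<phi>_def)
  then have "integral UNIV \<phi> = integral {0..real n} \<phi>"
    by (intro integral_spike_set empty_imp_negligible) auto
  also have "\<dots> = (\<Sum>m=1..n. integral {real m - 1..real m} \<phi>)"
    using absolutely_integrable_on_subinterval[OF abs_\<phi>, of 0 "real n"]
    by (intro integral_sum_unit_intervals) (simp add: set_lebesgue_integral_eq_integral(1))
  also have "\<dots> = 1 / fact (n - 1) *
      (\<Sum>m=1..n. integral {0..1} (\<lambda>t. G n m t * f (t + real m - 1)))"
    using piece by (simp flip: sum_distrib_left)
  finally show ?thesis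
    using piece int_\<phi> by (simp add: n_def)
qed

end
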